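(* For every positive integer $n$, $$y_{2,2}(n)=C_{2n}+4C_{2n-1}.$$
   Context: $C_m=\frac{1}{m+1}\binom{2m}{m}$ denotes the $m$-th Catalan number. $y_{2,2}(n)$ is the number of lattice paths from $(0,0)$ to $(2n,2n)$, composed only of unit steps to the right $(1,0)$ and up $(0,1)$, that avoid all the points $(2j,2j)$ with $0<j<n$. *)

theory Defs
  imports Complex_Main
begin

definition catalan :: "nat \<Rightarrow> real" where
  "catalan m = 1 / (real m + 1) * real ((2 * m) choose m)"

definition unit_step :: "nat \<times> nat \<Rightarrow> nat \<times> nat \<Rightarrow> bool" where
  "unit_step p q \<longleftrightarrow> q = (fst p + 1, snd p) \<or> q = (fst p, snd p + 1)"

(* A path is the list of all lattice points it visits, endpoints included. *)
definition lattice_path :: "nat \<times> nat \<Rightarrow> nat \<times> nat \<Rightarrow> (nat \<times> nat) list \<Rightarrow> bool" where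
  "lattice_path a b w \<longleftrightarrow> w \<noteq> [] \<and> hd w = a \<and> last w = b \<and> successively unit_step w"

definition y22 :: "nat \<Rightarrow> nat" where
  "y22 n = card {w. lattice_path (0, 0) (2 * n, 2 * n) w \<and>
                    (\<forall>j. 0 < j \<and> j < n \<longrightarrow> (2 * j, 2 * j) \<notin> set w)}"

end

theory Submission
  imports Defs "HOL-Computational_Algebra.Formal_Power_Series"
begin

(* Splitting a path at its first visit to a point (2k,2k) with k > 0 gives
   binom(4n,2n) = sum_{k=1..n} y22(k) * binom(4(n-k),2(n-k)).
   This determines y22, so it remains to see that the Catalan expression satisfies the same
   recurrence. Put a = sqrt(1-4z) and b = sqrt(1+4z). The central binomials with even index have
   generating function T = (1/a+1/b)/2, and since (a+b)^2 = 2+2ab and b^2-a^2 = 8z,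
   1/T = 2ab/(a+b) = (a+b) - (b-a)/(4z), whose coefficients are read off from a = 1-2z C(z),
   where C is the Catalan series. *)

section \<open>First-passage decomposition\<close>

definition double_diagonal :: "(nat \<times> nat) set" where
  "double_diagonal = {(2 * j, 2 * j) |j. 0 < j}"

text \<open>Using \<open>butlast\<close> exempts the endpoint, so a path may stop at a point of
  \<open>double_diagonal\<close> on its first visit there.\<close>

definition first_passage_paths :: "nat \<times> nat \<Rightarrow> (nat \<times> nat) list set" where
  "first_passage_paths p =
     {w. lattice_path (0, 0) p w \<and> set (butlast w) \<inter> double_diagonal = {}}"

definition avoiding_paths :: "nat \<times> nat \<Rightarrow> (nat \<times> nat) list set" where
  "avoiding_paths p = {w. lattice_path (0, 0) p w \<and> set w \<inter> double_diagonal = {}}"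

section \<open>Coordinate sums along a path\<close>

lemma lattice_path_snoc:
  "lattice_path a b (w @ [c]) \<longleftrightarrow>
     c = b \<and> (if w = [] then a = b else (\<exists>q. unit_step q b \<and> lattice_path a q w))"
  by (auto simp: lattice_path_def successively_append_iff hd_append simp del: split_paired_Ex)

text \<open>Every unit step raises the coordinate sum by one, so the sum at the endpoint is attained
  nowhere else.\<close>

lemma lattice_path_le:
  assumes "lattice_path a b w" "q \<in> set w"
  shows "q = b \<or> fst q + snd q < fst b + snd b"
  using assms
proof (induction w arbitrary: b rule: rev_induct)
  case Nil
  then show ?case by simp
next
  case (snoc c w)
  show ?case
  proof (cases "q = c")
    case True
    then show ?thesis using snoc.prems by (simp add: lattice_path_snoc)
  next
    case False
    with snoc.prems have "q \<in> set w" "w \<noteq> []" by auto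
    with snoc.prems obtain r where "unit_step r b" "lattice_path a r w"
      by (auto simp: lattice_path_snoc)
    then show ?thesis
      using snoc.IH[of r] \<open>q \<in> set w\<close> by (auto simp: unit_step_def)
  qed
qed

lemma lattice_path_butlast_less:
  assumes "lattice_path a b w" "q \<in> set (butlast w)"
  shows "fst q + snd q < fst b + snd b"
proof -
  obtain v c where w: "w = v @ [c]"
    using assms by (metis append_butlast_last_id lattice_path_def)
  with assms have "q \<in> set v" by simp
  with assms w obtain r where "unit_step r b" "lattice_path a r v"
    by (auto simp: lattice_path_snoc split: if_splits)
  then show ?thesis
    using lattice_path_le[of a r v q] \<open>q \<in> set v\<close> by (auto simp: unit_step_def)
qed

text \<open>The bound j < n may be traded for dropping the endpoint: points before the end have a
  smaller coordinate sum, so a visit to (2j,2j) there forces j < n.\<close>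

lemma y22_eq_card_first_passage: "y22 n = card (first_passage_paths (2 * n, 2 * n))"
proof -
  have "(\<forall>j. 0 < j \<and> j < n \<longrightarrow> (2 * j, 2 * j) \<notin> set w) \<longleftrightarrow>
        set (butlast w) \<inter> double_diagonal = {}"
    if w: "lattice_path (0, 0) (2 * n, 2 * n) w" for w
  proof
    assume avoid: "\<forall>j. 0 < j \<and> j < n \<longrightarrow> (2 * j, 2 * j) \<notin> set w"
    have "(2 * j, 2 * j) \<notin> set (butlast w)" if "0 < j" for j
    proof
      assume j: "(2 * j, 2 * j) \<in> set (butlast w)"
      then have "j < n" using lattice_path_butlast_less[OF w j] by simp
      then show False using avoid that in_set_butlastD[OF j] by simp
    qed
    then show "set (butlast w) \<inter> double_diagonal = {}"
      by (auto simp: double_diagonal_def)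
  next
    assume disj: "set (butlast w) \<inter> double_diagonal = {}"
    have "w = butlast w @ [(2 * n, 2 * n)]"
      using w by (metis append_butlast_last_id lattice_path_def)
    then have "set w = insert (2 * n, 2 * n) (set (butlast w))"
      by (metis list.simps(15) rotate1.simps(2) set_rotate1)
    then show "\<forall>j. 0 < j \<and> j < n \<longrightarrow> (2 * j, 2 * j) \<notin> set w"
      using disj by (auto simp: double_diagonal_def)
  qed
  then show ?thesis
    unfolding y22_def first_passage_paths_def
    by (intro arg_cong[where f = card] Collect_cong conj_cong refl)
qed

section \<open>Last-step recursion for the restricted counts\<close>

lemma first_passage_paths_origin: "first_passage_paths (0, 0) = {[(0, 0)]}"
proof (intro equalityI subsetI)
  fix w assume "w \<in> first_passage_paths (0, 0)"
  then have w: "lattice_path (0, 0) (0, 0) w" by (simp add: first_passage_paths_def)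
  then have "w \<noteq> []" by (simp add: lattice_path_def)
  have "butlast w = []"
    using lattice_path_butlast_less[OF w] by (cases "butlast w") auto
  then show "w \<in> {[(0, 0)]}"
    using w \<open>w \<noteq> []\<close> by (metis append_butlast_last_id append_Nil lattice_path_def singletonI)
qed (simp add: first_passage_paths_def lattice_path_def)

text \<open>Deleting the last point is the bijection behind the recursion. Away from the origin the
  one-point path is excluded, so a predecessor exists.\<close>

lemma first_passage_paths_step:
  assumes "p \<noteq> (0, 0)"
  shows "first_passage_paths p = (\<lambda>w. w @ [p]) ` (\<Union>q \<in> {q. unit_step q p}. avoiding_paths q)"
proof (intro equalityI subsetI)
  fix w assume w: "w \<in> first_passage_paths p"
  then have "w \<noteq> []" by (simp add: first_passage_paths_def lattice_path_def)
  then obtain v c where v: "w = v @ [c]" by (metis append_butlast_last_id)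
  then show "w \<in> (\<lambda>w. w @ [p]) ` (\<Union>q \<in> {q. unit_step q p}. avoiding_paths q)"
    using w assms
    by (auto simp: first_passage_paths_def avoiding_paths_def lattice_path_snoc split: if_splits)
next
  fix w assume "w \<in> (\<lambda>w. w @ [p]) ` (\<Union>q \<in> {q. unit_step q p}. avoiding_paths q)"
  then show "w \<in> first_passage_paths p"
    by (auto simp: first_passage_paths_def avoiding_paths_def lattice_path_snoc)
       (auto simp: lattice_path_def)
qed

lemma avoiding_paths_eq:
  "avoiding_paths p = (if p \<in> double_diagonal then {} else first_passage_paths p)"
proof -
  have "set w \<inter> double_diagonal = {} \<longleftrightarrow>
        p \<notin> double_diagonal \<and> set (butlast w) \<inter> double_diagonal = {}"
    if "lattice_path (0, 0) p w" for w
  proof -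
    have "w = butlast w @ [p]"
      using that by (metis append_butlast_last_id lattice_path_def)
    then have "set w = insert p (set (butlast w))"
      by (metis list.simps(15) rotate1.simps(2) set_rotate1)
    then show ?thesis by auto
  qed
  then show ?thesis by (auto simp: avoiding_paths_def first_passage_paths_def)
qed

lemma unit_step_pred:
  "{q. unit_step q (0, Suc b)} = {(0, b)}"
  "{q. unit_step q (Suc a, 0)} = {(a, 0)}"
  "{q. unit_step q (Suc a, Suc b)} = {(a, Suc b), (Suc a, b)}"
  by (auto simp: unit_step_def)

lemma finite_first_passage_paths: "finite (first_passage_paths (a, b))"
proof (induction "a + b" arbitrary: a b rule: less_induct)
  case less
  then have "finite (avoiding_paths (c, d))" if "c + d < a + b" for c d
    using that by (simp add: avoiding_paths_eq)
  then show ?case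
    by (cases a; cases b)
       (simp_all add: first_passage_paths_origin first_passage_paths_step unit_step_pred)
qed

lemma finite_avoiding_paths: "finite (avoiding_paths (a, b))"
  by (simp add: avoiding_paths_eq finite_first_passage_paths)

lemma card_first_passage_paths:
  "card (first_passage_paths (0, 0)) = 1"
  "card (first_passage_paths (Suc a, 0)) = card (avoiding_paths (a, 0))"
  "card (first_passage_paths (0, Suc b)) = card (avoiding_paths (0, b))"
  "card (first_passage_paths (Suc a, Suc b)) =
     card (avoiding_paths (a, Suc b)) + card (avoiding_paths (Suc a, b))"
proof -
  \<comment> \<open>The two families end at different points.\<close>
  have "avoiding_paths (a, Suc b) \<inter> avoiding_paths (Suc a, b) = {}"
    by (auto simp: avoiding_paths_def lattice_path_def)
  then show "card (first_passage_paths (Suc a, Suc b)) =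
     card (avoiding_paths (a, Suc b)) + card (avoiding_paths (Suc a, b))"
    by (simp add: first_passage_paths_step unit_step_pred card_image inj_on_def card_Un_disjoint
          finite_avoiding_paths)
qed (simp_all add: first_passage_paths_origin first_passage_paths_step unit_step_pred card_image inj_on_def)

lemma card_avoiding_paths:
  "card (avoiding_paths p) = (if p \<in> double_diagonal then 0 else card (first_passage_paths p))"
  by (simp add: avoiding_paths_eq)

section \<open>Unrestricted counts and the first visit\<close>

definition paths_between :: "nat \<Rightarrow> nat \<Rightarrow> nat \<Rightarrow> nat" where
  "paths_between k a b =
     (if 2 * k \<le> a \<and> 2 * k \<le> b then ((a - 2 * k) + (b - 2 * k)) choose (a - 2 * k) else 0)"

text \<open>\<open>paths_between k a b\<close> counts all paths from (2k,2k) to (a,b), and the last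
  step gives Pascal's rule. At the starting point (2k,2k) the rule fails by one: the left side is 1,
  the right side 0.\<close>

lemma paths_between_pascal:
  assumes "\<not> (Suc a = 2 * k \<and> Suc b = 2 * k)"
  shows "paths_between k (Suc a) (Suc b) = paths_between k a (Suc b) + paths_between k (Suc a) b"
proof -
  consider "2 * k \<le> a" "2 * k \<le> b" | "Suc a = 2 * k" "2 * k \<le> b" | "2 * k \<le> a" "Suc b = 2 * k"
    | "Suc a < 2 * k \<or> Suc b < 2 * k"
    using assms by linarith
  then show ?thesis
  proof cases
    case 1
    then obtain c d where "a = 2 * k + c" "b = 2 * k + d" by (metis le_Suc_ex)
    then show ?thesis
      using choose_reduce_nat[of "Suc c + Suc d" "Suc c"]
      by (simp add: paths_between_def Suc_diff_le)
  qed (auto simp: paths_between_def)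
qed

text \<open>Paths to (a,b) are sorted by their first visit (2k,2k), if any. Instead of cutting
  lists, the induction on a + b compares recursions. The bound \<open>K\<close> stays fixed
  throughout; \<open>a \<le> K\<close> ensures that no possible visit is missed.\<close>

lemma choose_first_passage:
  assumes "a \<le> K"
  shows "(a + b) choose a =
     card (avoiding_paths (a, b)) + (\<Sum>k=1..K. y22 k * paths_between k a b)"
  using assms
proof (induction "a + b" arbitrary: a b rule: less_induct)
  case less
  define S where "S a b = (\<Sum>k=1..K. y22 k * paths_between k a b)" for a b
  show ?case
    unfolding S_def[symmetric]
  proof (cases "a = 0 \<or> b = 0")
    case True
    have S0: "S c 0 = 0" "S 0 c = 0" for c
      by (auto simp: S_def paths_between_def intro!: sum.neutral)
    have D: "(c, 0) \<notin> double_diagonal" "(0, c) \<notin> double_diagonal" for c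
      by (auto simp: double_diagonal_def)
    have IH: "card (avoiding_paths (c, d)) = (c + d) choose c"
      if "c + d < a + b" "c \<le> K" "c = 0 \<or> d = 0" for c d
      using less.hyps[OF that(1,2)] that(3) S0 unfolding S_def[symmetric] by auto
    have "card (first_passage_paths (a, b)) = 1"
      using True less.prems by (cases a; cases b) (auto simp: card_first_passage_paths IH)
    then show "(a + b) choose a = card (avoiding_paths (a, b)) + S a b"
      using True S0 D by (auto simp: card_avoiding_paths)
  next
    case False
    then obtain a' b' where ab: "a = Suc a'" "b = Suc b'" by (metis not0_implies_Suc)
    have pascal: "(a + b) choose a = ((a' + b) choose a') + ((a + b') choose a)"
      by (simp add: ab)
    have "(a' + b) choose a' = card (avoiding_paths (a', b)) + S a' b"
      using less.hyps[of a' b] less.prems by (simp add: ab S_def)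
    moreover have "(a + b') choose a = card (avoiding_paths (a, b')) + S a b'"
      using less.hyps[of a b'] less.prems by (simp add: ab S_def)
    \<comment> \<open>The last-step recursion yields first-passage paths; it remains to treat an
      endpoint on \<open>double_diagonal\<close>.\<close>
    ultimately have main: "(a + b) choose a = card (first_passage_paths (a, b)) + (S a' b + S a b')"
      using pascal by (simp add: ab card_first_passage_paths)
    show "(a + b) choose a = card (avoiding_paths (a, b)) + S a b"
    proof (cases "(a, b) \<in> double_diagonal")
      case False
      then have "S a b = S a' b + S a b'"
        unfolding S_def sum.distrib[symmetric] ab
        by (intro sum.cong) (auto simp: double_diagonal_def ab paths_between_pascal algebra_simps)
      then show ?thesis using main False by (simp add: card_avoiding_paths)
    next
      case True
      then obtain j where j: "a = 2 * j" "b = 2 * j" "0 < j" by (auto simp: double_diagonal_def)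
      \<comment> \<open>At (2j,2j) the defect of Pascal's rule in the term k = j adds exactly
        \<open>y22 j\<close>, the number of first-passage paths that are no longer avoiding.\<close>
      have "S a b = (\<Sum>k=1..K. y22 k * paths_between k a' b + y22 k * paths_between k a b'
                       + (if k = j then y22 k else 0))"
        unfolding S_def
      proof (intro sum.cong refl)
        fix k
        show "y22 k * paths_between k a b = y22 k * paths_between k a' b
                + y22 k * paths_between k a b' + (if k = j then y22 k else 0)"
        proof (cases "k = j")
          case True
          with j ab have "paths_between k a b = 1" "paths_between k a' b = 0" "paths_between k a b' = 0"
            by (auto simp: paths_between_def)
          then show ?thesis using True by simp
        next
          case False
          then show ?thesis
            using paths_between_pascal[of a' k b'] j ab by (simp add: distrib_left)
        qed
      qed
      also have "\<dots> = S a' b + S a b' + y22 j"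
        using j less.prems by (simp add: S_def sum.distrib)
      finally show ?thesis
        using main True j by (simp add: card_avoiding_paths y22_eq_card_first_passage)
    qed
  qed
qed

text \<open>At a = b = 2n with n > 0 the endpoint is itself forbidden, so no avoiding paths remain,
  and the terms with k > n vanish.\<close>

lemma central_binomial_first_passage:
  assumes "0 < n"
  shows "(4 * n) choose (2 * n) = (\<Sum>k=1..n. y22 k * ((4 * (n - k)) choose (2 * (n - k))))"
proof -
  have "(4 * n) choose (2 * n) = (\<Sum>k=1..2 * n. y22 k * paths_between k (2 * n) (2 * n))"
    using choose_first_passage[of "2 * n" "2 * n" "2 * n"] assms
    by (auto simp: card_avoiding_paths double_diagonal_def)
  also have "\<dots> = (\<Sum>k=1..n. y22 k * paths_between k (2 * n) (2 * n))"
    by (rule sum.mono_neutral_right) (auto simp: paths_between_def)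
  also have "\<dots> = (\<Sum>k=1..n. y22 k * ((4 * (n - k)) choose (2 * (n - k))))"
    by (intro sum.cong) (auto simp: paths_between_def simp flip: diff_mult_distrib2)
  finally show ?thesis .
qed

section \<open>Generating functions\<close>

unbundle fps_syntax

section \<open>Binomial series and Catalan numbers\<close>

lemma Suc_times_central_binomial:
  "(real n + 1) * real ((2 * Suc n) choose Suc n) = 2 * (2 * real n + 1) * real ((2 * n) choose n)"
proof -
  have "Suc n * ((2 * n + 1) choose Suc n) = (2 * n + 1) * ((2 * n) choose n)"
    using Suc_times_binomial[of n "2 * n"] by simp
  \<comment> \<open>The two middle entries of row 2n+1 are equal, so Pascal's rule doubles one of
    them.\<close>
  moreover have "(2 * Suc n) choose Suc n = 2 * ((2 * n + 1) choose Suc n)"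
    using binomial_symmetric[of n "2 * n + 1"] by simp
  ultimately have "Suc n * ((2 * Suc n) choose Suc n) = 2 * (2 * n + 1) * ((2 * n) choose n)"
    by (metis mult.assoc mult.left_commute)
  then have "real (Suc n * ((2 * Suc n) choose Suc n)) = real (2 * (2 * n + 1) * ((2 * n) choose n))"
    by (rule arg_cong)
  then show ?thesis by (simp add: algebra_simps)
qed

text \<open>Both sides start at 1 and have the same ratio of consecutive terms,
  2(2n+1)/(n+1).\<close>

lemma gbinomial_neg_half: "(-4) ^ n * ((- 1 / 2 :: real) gchoose n) = real ((2 * n) choose n)"
proof (induction n)
  case 0
  then show ?case by simp
next
  case (Suc n)
  define g where "g = (- 1 / 2 :: real) gchoose n"
  define g' where "g' = (- 1 / 2 :: real) gchoose Suc n"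
  have "(real n + 1) * g' = (- 1 / 2 - real n) * g"
    using gbinomial_mult_1[of "- 1 / 2 :: real" n] by (simp add: g_def g'_def algebra_simps)
  then have "(-4) ^ Suc n * ((real n + 1) * g') = (-4) ^ Suc n * ((- 1 / 2 - real n) * g)"
    by simp
  also have "\<dots> = 2 * (2 * real n + 1) * ((-4) ^ n * g)"
    by (simp add: algebra_simps)
  also have "\<dots> = (real n + 1) * real ((2 * Suc n) choose Suc n)"
    unfolding g_def Suc.IH Suc_times_central_binomial ..
  finally have "(real n + 1) * ((-4) ^ Suc n * g') = (real n + 1) * real ((2 * Suc n) choose Suc n)"
    by (simp only: mult.left_commute)
  then show ?case
    unfolding g'_def by (subst (asm) mult_cancel_left) linarith
qed

text \<open>The formal power series (1 + cX)^r.\<close>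

definition fps_binomial_scaled :: "real \<Rightarrow> real \<Rightarrow> real fps" where
  "fps_binomial_scaled r c = fps_binomial r oo (fps_const c * fps_X)"

lemma fps_binomial_scaled_nth: "fps_binomial_scaled r c $ n = c ^ n * (r gchoose n)"
  by (simp add: fps_binomial_scaled_def fps_compose_linear)

lemma fps_binomial_scaled_mult:
  "fps_binomial_scaled r c * fps_binomial_scaled s c = fps_binomial_scaled (r + s) c"
  by (simp add: fps_binomial_scaled_def fps_binomial_add_mult fps_compose_mult_distrib)

lemma fps_binomial_scaled_0: "fps_binomial_scaled 0 c = 1"
  by (simp add: fps_binomial_scaled_def)

lemma fps_binomial_scaled_1: "fps_binomial_scaled 1 c = 1 + fps_const c * fps_X"
  by (simp add: fps_binomial_scaled_def fps_binomial_1 fps_compose_add_distrib)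

text \<open>Changing the sign of c amounts to substituting -X for X; this links the series for 1-4X
  and 1+4X.\<close>

lemma fps_binomial_scaled_neg: "fps_binomial_scaled r (- c) $ n = (-1) ^ n * fps_binomial_scaled r c $ n"
  by (simp add: fps_binomial_scaled_nth power_minus[of c])

lemma inverse_sqrt_nth: "fps_binomial_scaled (- 1 / 2) (-4) $ n = real ((2 * n) choose n)"
  by (simp only: fps_binomial_scaled_nth gbinomial_neg_half)

text \<open>Writing the square root of 1-4X as (1-4X) times its inverse square root turns the
  coefficient into a central binomial minus four times the preceding one.\<close>

lemma sqrt_nth_Suc: "fps_binomial_scaled (1 / 2) (-4) $ Suc n = - 2 * catalan n"
proof -
  have "fps_binomial_scaled (1 / 2) (-4) =
        (1 + fps_const (-4) * fps_X) * fps_binomial_scaled (- 1 / 2) (-4)"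
    using fps_binomial_scaled_mult[of 1 "-4" "- 1 / 2"] by (simp add: fps_binomial_scaled_1)
  also have "\<dots> = fps_binomial_scaled (- 1 / 2) (-4)
               + fps_const (-4) * (fps_X * fps_binomial_scaled (- 1 / 2) (-4))"
    by (simp add: algebra_simps)
  finally have "fps_binomial_scaled (1 / 2) (-4) $ Suc n =
      real ((2 * Suc n) choose Suc n) - 4 * real ((2 * n) choose n)"
    using inverse_sqrt_nth by (simp del: mult_Suc_right binomial_Suc_Suc)
  also have "\<dots> = - 2 * catalan n"
  proof -
    have "real ((2 * Suc n) choose Suc n) = 2 * (2 * real n + 1) * real ((2 * n) choose n) / (real n + 1)"
      using Suc_times_central_binomial[of n] by (simp add: field_simps del: binomial_Suc_Suc mult_Suc_right)
    then show ?thesis unfolding catalan_def by (simp add: field_simps del: binomial_Suc_Suc mult_Suc_right)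
  qed
  finally show ?thesis .
qed

section \<open>The recurrence for the Catalan expression\<close>

lemma fps_mult_4X_nth_Suc: "(4 * fps_X * f) $ Suc n = 4 * (f $ n :: real)"
proof -
  have eq: "4 * fps_X * f = fps_const 4 * (fps_X * f)" by (simp add: numeral_fps_const mult.assoc)
  show ?thesis unfolding eq by simp
qed

text \<open>Here \<open>A\<close>, \<open>A'\<close>, \<open>B\<close>, \<open>B'\<close> are a, b,
  1/a, 1/b, so \<open>B + B'\<close> is 2T. The recurrence is T(1 - Y) = 1 read off at exponent
  2n.\<close>

lemma catalan_central_binomial:
  fixes y :: "nat \<Rightarrow> real"
  defines "y \<equiv> \<lambda>k. catalan (2 * k) + 4 * catalan (2 * k - 1)"
  assumes "0 < n"
  shows "real ((4 * n) choose (2 * n)) = (\<Sum>k=1..n. y k * real ((4 * (n - k)) choose (2 * (n - k))))"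
proof -
  define A where "A = fps_binomial_scaled (1 / 2) (-4)"
  define A' where "A' = fps_binomial_scaled (1 / 2) 4"
  define B where "B = fps_binomial_scaled (- 1 / 2) (-4)"
  define B' where "B' = fps_binomial_scaled (- 1 / 2) 4"
  \<comment> \<open>The value \<open>y k\<close> sits at exponent 2k; the constant term is 0 because
    first visits have k > 0.\<close>
  define Y where "Y = Abs_fps (\<lambda>m. if even m \<and> 0 < m then catalan m + 4 * catalan (m - 1) else 0)"
  have AA: "A * A = 1 - 4 * fps_X" "A' * A' = 1 + 4 * fps_X" and BA: "B * A = 1" "B' * A' = 1"
    by (simp_all add: A_def A'_def B_def B'_def fps_binomial_scaled_mult fps_binomial_scaled_1
         fps_binomial_scaled_0 numeral_fps_const flip: fps_const_neg)
  have A'_nth: "A' $ m = (-1) ^ m * A $ m" and B'_nth: "B' $ m = (-1) ^ m * B $ m" for m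
    using fps_binomial_scaled_neg[of _ "-4"] by (simp_all add: A_def A'_def B_def B'_def)
  have B_nth: "B $ m = real ((2 * m) choose m)" for m by (simp only: B_def inverse_sqrt_nth)
  have A0: "A $ 0 = 1" by (simp add: A_def fps_binomial_scaled_nth)
  have A_Suc: "A $ Suc m = - 2 * catalan m" for m by (simp only: A_def sqrt_nth_Suc)
  have cat0: "catalan 0 = 1" by (simp add: catalan_def)
  \<comment> \<open>This is 1 - Y = (a+b) - (b-a)/(4z), cleared of its denominator.\<close>
  have Yeq: "4 * fps_X * (1 - Y) = 4 * fps_X * (A + A') - (A' - A)"
  proof (rule fps_ext)
    fix m
    show "(4 * fps_X * (1 - Y)) $ m = (4 * fps_X * (A + A') - (A' - A)) $ m"
    proof (cases m)
      case 0
      then show ?thesis by (simp add: A'_nth)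
    next
      case (Suc l)
      show ?thesis
        unfolding Suc fps_sub_nth[of "_ * _"] fps_mult_4X_nth_Suc
        \<comment> \<open>The case l = 0 is separate: \<open>A + A'\<close> contributes 2 and
          \<open>A' - A\<close> removes \<open>catalan 0\<close>, leaving 1.\<close>
        by (cases l) (auto simp: A'_nth A0 A_Suc Y_def cat0)
    qed
  qed
  have TY: "(B + B') * (1 - Y) = 2"
  proof -
    \<comment> \<open>This factor clears the inverses and 4X, and can be cancelled again in the
      integral domain of series.\<close>
    have nz: "8 * fps_X * (A * A') \<noteq> (0 :: real fps)"
      using BA by (auto simp: fps_X_neq_zero)
    have "(8 * fps_X * (A * A')) * ((B + B') * (1 - Y))
        = 2 * ((B * A) * A' + (B' * A') * A) * (4 * fps_X * (1 - Y))"
      by (simp add: algebra_simps)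
    also have "\<dots> = 2 * (A' + A) * (4 * fps_X * (A + A') - (A' - A))"
      unfolding BA Yeq by simp
    also have "\<dots> = 8 * fps_X * (A * A + A' * A' + 2 * (A * A')) - 2 * (A' * A' - A * A)"
      by (simp add: algebra_simps)
    \<comment> \<open>The squares sum to 2 and differ by 8X, so the two terms 16X cancel.\<close>
    also have "\<dots> = (8 * fps_X * (A * A')) * 2"
      unfolding AA by (simp add: algebra_simps)
    finally show ?thesis using nz by (metis mult_left_cancel)
  qed
  have BB: "(B + B') $ m = (if even m then 2 * real ((2 * m) choose m) else 0)" for m
    by (auto simp: B'_nth B_nth)
  \<comment> \<open>The constant series 2 has no coefficient at 2n > 0.\<close>
  have "((B + B') * Y) $ (2 * n) = (B + B') $ (2 * n)"
    using arg_cong[OF TY, of "\<lambda>f. f $ (2 * n)"] assms(2)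
    by (simp add: right_diff_distrib numeral_fps_const)
  then have "2 * real ((4 * n) choose (2 * n)) = (Y * (B + B')) $ (2 * n)"
    using BB by (simp add: mult.commute)
  also have "\<dots> = (\<Sum>m=0..2 * n. Y $ m * (B + B') $ (2 * n - m))"
    by (simp only: fps_mult_nth)
  also have "\<dots> = (\<Sum>m\<in>(\<lambda>k. 2 * k) ` {1..n}. Y $ m * (B + B') $ (2 * n - m))"
  proof (rule sum.mono_neutral_right)
    show "\<forall>m\<in>{0..2 * n} - (\<lambda>k. 2 * k) ` {1..n}. Y $ m * (B + B') $ (2 * n - m) = 0"
    proof
      fix m assume m: "m \<in> {0..2 * n} - (\<lambda>k. 2 * k) ` {1..n}"
      have "\<not> (even m \<and> 0 < m)"
        using m by (auto elim!: evenE)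
      then have "Y $ m = 0" by (auto simp: Y_def)
      then show "Y $ m * (B + B') $ (2 * n - m) = 0" by simp
    qed
  qed auto
  also have "\<dots> = (\<Sum>k=1..n. Y $ (2 * k) * (B + B') $ (2 * n - 2 * k))"
    by (subst sum.reindex) (auto simp: inj_on_def)
  also have "\<dots> = (\<Sum>k=1..n. 2 * (y k * real ((4 * (n - k)) choose (2 * (n - k)))))"
    by (intro sum.cong refl, unfold BB) (auto simp: Y_def y_def diff_mult_distrib2)
  finally show ?thesis by (simp flip: sum_distrib_left)
qed

theorem theorem19:
  fixes n :: nat
  assumes "n > 0"
  shows "real (y22 n) = catalan (2 * n) + 4 * catalan (2 * n - 1)"
  using assms
proof (induction n rule: less_induct)
  case (less n)
  define c where "c k = real ((4 * (n - k)) choose (2 * (n - k)))" for k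
  define y where "y k = catalan (2 * k) + 4 * catalan (2 * k - 1)" for k
  have split: "{1..n} = insert n {1..<n}" using less.prems by auto
  have "(\<Sum>k=1..n. real (y22 k) * c k) = (\<Sum>k=1..n. y k * c k)"
    using arg_cong[OF central_binomial_first_passage[OF less.prems], of real]
      catalan_central_binomial[OF less.prems]
    by (simp add: c_def y_def)
  moreover have "(\<Sum>k=1..<n. real (y22 k) * c k) = (\<Sum>k=1..<n. y k * c k)"
    using less.IH by (intro sum.cong) (auto simp: y_def)
  \<comment> \<open>Both sequences satisfy the same recurrence and agree below n, so only the terms
    k = n are left; their weight \<open>c n\<close> is 1.\<close>
  ultimately have "real (y22 n) * c n = y n * c n"
    unfolding split by simp
  then show ?case by (simp add: c_def y_def)
qed

end
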